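(* Let $\Sigma_5=\{0,1,2,3,4\}$ and let $h:\Sigma_5^*\to\Sigma_5^*$ be the morphism $h(0)=012321012340121012321234$, $h(1)=012101234323401234321234$, $h(2)=012101232123401232101234$, $h(3)=012321234323401232101234$, $h(4)=012321234012101234321234$. If $w\in\Sigma_5^*$ is squarefree and contains none of the subwords $02,03,04,14,20,30,41$, then $h(w)$ is squarefree and contains none of the subwords $02,03,04,13,14,20,24,30,31,41,42,010,434$.
   Context: A square is a nonempty word $xx$; squarefree means containing no square as a (contiguous) subword. *)

theory Defs
  imports "HOL-Library.Sublist"
begin

definition Sigma5 :: "nat set" where
  "Sigma5 = {0, 1, 2, 3, 4}"

definition is_square :: "'a list \<Rightarrow> bool" where
  "is_square u \<longleftrightarrow> (\<exists>x. x \<noteq> [] \<and> u = x @ x)"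

definition squarefree_word :: "'a list \<Rightarrow> bool" where
  "squarefree_word w \<longleftrightarrow> \<not> (\<exists>u. is_square u \<and> sublist u w)"

text \<open>Only the values on letters of \<^const>\<open>Sigma5\<close> matter; the last clause is an arbitrary totalisation.\<close>

definition h_letter :: "nat \<Rightarrow> nat list" where
  "h_letter a =
    (if a = 0 then [0,1,2,3,2,1,0,1,2,3,4,0,1,2,1,0,1,2,3,2,1,2,3,4]
     else if a = 1 then [0,1,2,1,0,1,2,3,4,3,2,3,4,0,1,2,3,4,3,2,1,2,3,4]
     else if a = 2 then [0,1,2,1,0,1,2,3,2,1,2,3,4,0,1,2,3,2,1,0,1,2,3,4]
     else if a = 3 then [0,1,2,3,2,1,2,3,4,3,2,3,4,0,1,2,3,2,1,0,1,2,3,4]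
     else if a = 4 then [0,1,2,3,2,1,2,3,4,0,1,2,1,0,1,2,3,4,3,2,1,2,3,4]
     else [])"

definition h :: "nat list \<Rightarrow> nat list" where
  "h w = concat (map h_letter w)"

lemma h_append: "h (u @ v) = h u @ h v"
  by (simp add: h_def)

lemma h_in_lists_Sigma5: "h w \<in> lists Sigma5"
  by (induction w) (auto simp: h_def h_letter_def Sigma5_def)

end

theory Submission
  imports Defs
begin

text \<open>
  The morphism is 24-uniform, so a square \<open>xx\<close> in \<open>h w\<close> is treated according to the length \<open>p\<close>
  of \<open>x\<close>. If \<open>p \<le> 30\<close>, the square lies in the image of a factor of \<open>w\<close> of length at most 4, and
  these images are inspected one by one. If \<open>p \<ge> 31\<close>, then \<open>x\<close> contains one of six marker words, each
  of which occurs in \<open>h w\<close> at positions of a single residue class modulo 24; as the two copies of the marker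
  are at distance \<open>p\<close>, this forces \<open>24 dvd p\<close>. Finally, if \<open>p = 24 q\<close>, then the square projects to a
  square of period \<open>q\<close> in \<open>w\<close>, because a letter is determined both by the first 10 letters of its
  image and by the last 15: whichever way the square cuts the block it starts in, one of the two
  partial blocks at its ends can be decoded.
\<close>

section \<open>Words as paths in the graph of permitted letter pairs\<close>

text \<open>Of the 20 pairs of distinct letters, these 13 remain after the seven forbidden ones are
  removed.\<close>

definition succs :: "nat \<Rightarrow> nat list" where
  "succs a = [[1], [0,2,3], [1,3,4], [1,2,4], [0,2,3]] ! a"

fun adjacent :: "nat \<Rightarrow> nat list \<Rightarrow> bool" where
  "adjacent a [] = True"
| "adjacent a (b # v) = (b \<in> set (succs a))"

fun is_path :: "nat list \<Rightarrow> bool" where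
  "is_path [] = True"
| "is_path (a # v) = (a \<in> {0,1,2,3,4} \<and> adjacent a v \<and> is_path v)"

text \<open>The empty word is kept at every level, so shorter paths stay in the list; they serve
  windows near the end of \<open>w\<close>.\<close>

fun paths :: "nat \<Rightarrow> nat list list" where
  "paths 0 = [[]]"
| "paths (Suc n) = [] # [a # v. v \<leftarrow> paths n, a \<leftarrow> [0,1,2,3,4], adjacent a v]"

lemma in_paths: "is_path v \<Longrightarrow> length v \<le> n \<Longrightarrow> v \<in> set (paths n)"
proof (induction n arbitrary: v)
  case 0
  then show ?case by simp
next
  case (Suc n)
  show ?case
  proof (cases v)
    case (Cons a u)
    with Suc have "u \<in> set (paths n)" "a \<in> {0,1,2,3,4}" "adjacent a u"
      by simp_all
    then show ?thesis
      unfolding Cons by (auto intro: bexI[of _ u])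
  qed simp
qed

lemma is_path_drop: "is_path w \<Longrightarrow> is_path (drop n w)"
proof (induction n arbitrary: w)
  case (Suc n)
  then show ?case by (cases w) auto
qed simp

lemma adjacent_take: "adjacent a v \<Longrightarrow> adjacent a (take n v)"
  by (cases v; cases n) auto

lemma is_path_take: "is_path w \<Longrightarrow> is_path (take n w)"
proof (induction n arbitrary: w)
  case (Suc n)
  then show ?case by (cases w) (auto simp: adjacent_take)
qed simp

lemma is_path_Sigma5: "is_path w \<Longrightarrow> w \<in> lists Sigma5"
  by (induction w) (auto simp: Sigma5_def)

lemma sublist_ConsI: "sublist u v \<Longrightarrow> sublist u (a # v)"
  by (simp add: sublist_Cons_right)

lemma is_pathI:
  assumes "w \<in> lists Sigma5" and "squarefree_word w"
    and "\<forall>u \<in> {[0,2], [0,3], [0,4], [1,4], [2,0], [3,0], [4,1]}. \<not> sublist u w"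
  shows "is_path w"
  using assms
proof (induction w rule: list.induct)
  case (Cons a v)
  have "squarefree_word v"
    using Cons.prems(2) unfolding squarefree_word_def by (meson sublist_ConsI)
  moreover have "\<forall>u \<in> {[0,2], [0,3], [0,4], [1,4], [2,0], [3,0], [4,1]}. \<not> sublist u v"
    using Cons.prems(3) by (meson sublist_ConsI)
  ultimately have "is_path v"
    using Cons.IH Cons.prems(1) by simp
  moreover have "adjacent a v"
  proof (cases v)
    case (Cons b v')
    have sub: "sublist [a, b] (a # v)"
      using Cons by (simp add: sublist_Cons_right)
    have "a \<noteq> b"
    proof
      assume "a = b"
      then have "is_square [a, b]"
        unfolding is_square_def by (intro exI[of _ "[a]"]) simp
      with sub Cons.prems(2) show False
        unfolding squarefree_word_def by blast
    qed
    moreover have "[a, b] \<notin> {[0,2], [0,3], [0,4], [1,4], [2,0], [3,0], [4,1]}"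
      using sub Cons.prems(3) by blast
    moreover have "a \<in> {0,1,2,3,4}" "b \<in> {0,1,2,3,4}"
      using Cons.prems(1) Cons by (auto simp: Sigma5_def)
    ultimately show ?thesis
      using Cons by (auto simp: succs_def)
  qed simp
  ultimately show ?case
    using Cons.prems(1) by (auto simp: Sigma5_def)
qed simp


section \<open>Positions in the image\<close>

lemma length_h_letter: "a \<in> Sigma5 \<Longrightarrow> length (h_letter a) = 24"
  by (auto simp: Sigma5_def h_letter_def)

lemma h_Nil: "h [] = []"
  by (simp add: h_def)

lemma h_Cons: "h (a # v) = h_letter a @ h v"
  by (simp add: h_def)

lemma length_h: "w \<in> lists Sigma5 \<Longrightarrow> length (h w) = 24 * length w"
  by (induction w) (auto simp: h_Nil h_Cons length_h_letter)

lemma drop_h: "w \<in> lists Sigma5 \<Longrightarrow> drop (24 * i) (h w) = h (drop i w)"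
proof (induction i arbitrary: w)
  case (Suc i)
  show ?case
  proof (cases w)
    case (Cons a v)
    with Suc have "drop (24 * i) (h v) = h (drop i v)" "length (h_letter a) = 24"
      by (auto simp: length_h_letter)
    with Cons show ?thesis by (simp add: h_Cons)
  qed (simp add: h_Nil)
qed simp

lemma h_nth:
  assumes "w \<in> lists Sigma5" "i < length w" "t < 24"
  shows "h w ! (24 * i + t) = h_letter (w ! i) ! t"
proof -
  have "w ! i \<in> Sigma5"
    using assms by auto
  have "h w ! (24 * i + t) = drop (24 * i) (h w) ! t"
    using assms by (simp add: length_h)
  also have "\<dots> = h (w ! i # drop (Suc i) w) ! t"
    using assms by (simp add: drop_h Cons_nth_drop_Suc)
  also have "\<dots> = h_letter (w ! i) ! t"
    using \<open>w ! i \<in> Sigma5\<close> assms by (simp add: h_Cons nth_append length_h_letter)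
  finally show ?thesis .
qed

lemma factor_in_short_path:
  assumes "is_path w" and pre: "prefix u (drop s (h w))" and len: "s mod 24 + length u \<le> 24 * n"
  shows "\<exists>v \<in> set (paths n). prefix u (drop (s mod 24) (h v))"
proof -
  define r where "r = s mod 24"
  define z where "z = drop (s div 24) w"
  have w: "w \<in> lists Sigma5" and z: "is_path z"
    using assms(1) by (auto simp: is_path_Sigma5 z_def is_path_drop)
  have "drop s (h w) = drop r (drop (24 * (s div 24)) (h w))"
    by (simp add: r_def)
  also have "\<dots> = drop r (h (take n z) @ h (drop n z))"
    using w by (simp add: drop_h flip: z_def h_append)
  finally have pre': "prefix u (drop r (h (take n z) @ h (drop n z)))"
    using pre by simp
  have "prefix u (drop r (h (take n z)))"
  proof (cases "length z \<le> n")
    case True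
    then show ?thesis using pre' by (simp add: h_Nil)
  next
    case False
    then have "length (h (take n z)) = 24 * n"
      using z by (simp add: length_h is_path_Sigma5 is_path_take)
    moreover from this have "length u \<le> length (drop r (h (take n z)))"
      using len by (simp add: r_def)
    ultimately show ?thesis
      using pre' prefix_length_prefix by fastforce
  qed
  moreover have "take n z \<in> set (paths n)"
    using z by (simp add: in_paths is_path_take)
  ultimately show ?thesis
    by (auto simp: r_def)
qed


section \<open>Short squares\<close>

text \<open>
  The conditionals make the evaluation stop at the first mismatch, which conjunctions and the
  library's \<^const>\<open>prefix\<close> would not.
\<close>

fun agree :: "nat \<Rightarrow> 'a list \<Rightarrow> 'a list \<Rightarrow> bool" where
  "agree 0 xs ys = True"
| "agree (Suc n) (x # xs) (y # ys) = (if x = y then agree n xs ys else False)"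
| "agree (Suc n) xs ys = False"

lemma agree_iff: "agree n xs ys \<longleftrightarrow> n \<le> length xs \<and> n \<le> length ys \<and> take n xs = take n ys"
  by (induction n xs ys rule: agree.induct) auto

lemma agree_length_iff_prefix: "agree (length m) m xs \<longleftrightarrow> prefix m xs"
  by (auto simp: agree_iff prefix_def) (metis append_take_drop_id)

text \<open>Here \<open>ys\<close> stands for \<open>xs\<close> shifted by \<open>p\<close>; moving
  both forward together tests the first \<open>k\<close> starts without recomputing the
  shift.\<close>

fun no_square_within :: "nat \<Rightarrow> nat \<Rightarrow> 'a list \<Rightarrow> 'a list \<Rightarrow> bool" where
  "no_square_within (Suc k) p (x # xs) (y # ys) =
     (if agree p (x # xs) (y # ys) then False else no_square_within k p xs ys)"
| "no_square_within k p xs ys = True"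

lemma no_square_withinD:
  "no_square_within k p xs ys \<Longrightarrow> r < k \<Longrightarrow> p > 0 \<Longrightarrow> \<not> agree p (drop r xs) (drop r ys)"
proof (induction k p xs ys arbitrary: r rule: no_square_within.induct)
  case (1 k p x xs y ys)
  then show ?case by (cases r) (auto split: if_splits)
qed (auto simp: agree_iff)

text \<open>Four blocks suffice, as an offset of at most 23 plus a length of at most 60 is below 96.
  A path such as 1010 is itself a square, but the square it yields has period 48, outside the tested
  range.\<close>

lemma no_short_square_in_short_paths:
  "\<forall>v \<in> set (paths 4). \<forall>p \<in> set [1..<31]. no_square_within 24 p (h v) (drop p (h v))"
  by code_simp

lemma no_short_square:
  assumes "is_path w" and "x \<noteq> []" and "length x \<le> 30"
  shows "\<not> prefix (x @ x) (drop s (h w))"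
proof
  assume "prefix (x @ x) (drop s (h w))"
  moreover have "s mod 24 < 24" by simp
  then have "s mod 24 + length (x @ x) \<le> 24 * 4"
    using assms(3) unfolding length_append by linarith
  ultimately obtain v where v: "v \<in> set (paths 4)" "prefix (x @ x) (drop (s mod 24) (h v))"
    using factor_in_short_path[OF assms(1)] by blast
  from v(2) obtain y where y: "drop (s mod 24) (h v) = x @ x @ y"
    by (auto simp: prefix_def)
  have "drop (s mod 24) (drop (length x) (h v)) = drop (length x) (drop (s mod 24) (h v))"
    by (simp add: add.commute)
  then have "agree (length x) (drop (s mod 24) (h v)) (drop (s mod 24) (drop (length x) (h v)))"
    using y by (simp add: agree_iff)
  moreover have "length x \<in> set [1..<31]" "length x > 0"
    using assms by (auto simp: Suc_le_eq)
  ultimately show False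
    using no_short_square_in_short_paths v(1) no_square_withinD[of 24] by (meson \<open>s mod 24 < 24\<close>)
qed


section \<open>Synchronisation\<close>

text \<open>
  Found by a greedy search among the shortest words that occur in a single residue class modulo 24,
  which is recorded next to each.
\<close>

definition markers :: "(nat list \<times> nat) list" where
  "markers =
    [([3,2,3], 9), ([4,3,2,1], 17), ([4,0,1,2,3,2,1,2], 23), ([2,3,2,1,2,3,4,0,1,2,3], 6),
     ([1,0,1,2,3,2,1,2,3,4,0,1,2,1], 14),
     ([1,2,3,4,0,1,2,3,2,1,0,1,2,3,4,0,1,2,1,0,1,2,3,2], 20)]"

lemma length_marker: "(m, r) \<in> set markers \<Longrightarrow> length m \<le> 24"
  by (auto simp: markers_def)

text \<open>A marker has at most 24 letters, so one that starts in the first block ends within two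
  blocks.\<close>

lemma marker_residue_short:
  "\<forall>v \<in> set (paths 2). \<forall>(m, r) \<in> set markers. \<forall>j \<in> set [0..<24].
     agree (length m) m (drop j (h v)) \<longrightarrow> j = r"
  by code_simp

lemma marker_residue:
  assumes "is_path w" and m: "(m, r) \<in> set markers" and "prefix m (drop s (h w))"
  shows "s mod 24 = r"
proof -
  have "s mod 24 < 24" by simp
  then have "s mod 24 + length m \<le> 24 * 2"
    using length_marker[OF m] by linarith
  then obtain v where "v \<in> set (paths 2)" "prefix m (drop (s mod 24) (h v))"
    using factor_in_short_path assms by blast
  moreover have "s mod 24 \<in> set [0..<24]" by simp
  ultimately show ?thesis
    using marker_residue_short m by (fastforce simp: agree_length_iff_prefix)
qed

fun occurs_within :: "nat \<Rightarrow> 'a list \<Rightarrow> 'a list \<Rightarrow> bool" where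
  "occurs_within 0 m xs = False"
| "occurs_within (Suc k) m xs = (if agree (length m) m xs then True else occurs_within k m (tl xs))"

lemma occurs_withinD: "occurs_within k m xs \<Longrightarrow> \<exists>j<k. prefix m (drop j xs)"
proof (induction k arbitrary: xs)
  case (Suc k)
  show ?case
  proof (cases "prefix m xs")
    case False
    with Suc obtain j where "j < k" "prefix m (drop j (tl xs))"
      by (auto simp: agree_length_iff_prefix)
    then show ?thesis
      by (intro exI[of _ "Suc j"]) (simp add: drop_Suc)
  qed auto
qed simp

text \<open>A marker lies within the first 31 letters iff it starts at one of the first \<open>32 - length m\<close>.\<close>

fun contains_marker :: "('a list \<times> 'b) list \<Rightarrow> 'a list \<Rightarrow> bool" where
  "contains_marker [] xs = False"
| "contains_marker ((m, r) # ms) xs =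
     (if occurs_within (32 - length m) m xs then True else contains_marker ms xs)"

lemma contains_markerD:
  "contains_marker ms xs \<Longrightarrow> \<exists>(m, r) \<in> set ms. \<exists>j < 32 - length m. prefix m (drop j xs)"
  by (induction ms xs rule: contains_marker.induct)
    (auto split: if_splits dest!: occurs_withinD)

text \<open>A window of 31 letters that starts in the first block ends within 54 letters, hence
  within three blocks.\<close>

lemma marker_in_long_window_short:
  "\<forall>v \<in> set (paths 3). \<forall>j \<in> set [0..<24].
     j + 31 \<le> length (h v) \<longrightarrow> contains_marker markers (drop j (h v))"
  by code_simp

lemma marker_in_long_window:
  assumes "is_path w" and "prefix x (drop s (h w))" and "length x \<ge> 31"
  obtains m r j where "(m, r) \<in> set markers" and "prefix m (drop j x)"
proof -
  define y where "y = take 31 x"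
  have y: "length y = 31" "prefix y (drop s (h w))"
    using assms take_is_prefix[of 31 x] by (auto simp: y_def intro: prefix_order.trans)
  have "s mod 24 < 24" by simp
  then have "s mod 24 + length y \<le> 24 * 3"
    using y by linarith
  then obtain v where v: "v \<in> set (paths 3)" "prefix y (drop (s mod 24) (h v))"
    using factor_in_short_path assms(1) y(2) by blast
  have "31 \<le> length (h v) - s mod 24"
    using prefix_length_le[OF v(2)] y(1) by simp
  then have "contains_marker markers (drop (s mod 24) (h v))"
    using marker_in_long_window_short v(1) by simp
  then obtain m r j where m: "(m, r) \<in> set markers" "j < 32 - length m"
      "prefix m (drop j (drop (s mod 24) (h v)))"
    using contains_markerD by blast
  obtain y' where y': "drop (s mod 24) (h v) = y @ y'"
    using v(2) by (auto simp: prefix_def)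
  have "prefix m (drop j y @ y')"
    using m y' y(1) by simp
  \<comment> \<open>The bound \<open>j < 32 - length m\<close> places the marker inside the 31
    letters of \<open>y\<close>, not merely inside \<open>h v\<close>.\<close>
  moreover have "length m \<le> length (drop j y)"
    using m(2) y(1) by simp
  ultimately have "prefix m (drop j y)"
    by (auto simp: prefix_def append_eq_append_conv2)
  moreover have "prefix (drop j y) (drop j x)"
    by (simp add: y_def drop_take take_is_prefix)
  ultimately show ?thesis
    using that m(1) prefix_order.trans by blast
qed

text \<open>A marker inside \<open>x\<close> occurs in both copies, at positions \<open>p\<close>
  apart that share its residue modulo 24.\<close>

lemma long_repetition_dvd:
  assumes "is_path w" and "length x \<ge> 31"
    and "prefix x (drop s (h w))" and "prefix x (drop (s + p) (h w))"
  shows "24 dvd p"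
proof -
  obtain m r j where m: "(m, r) \<in> set markers" "prefix m (drop j x)"
    using marker_in_long_window assms by blast
  have pre: "prefix m (drop (j + t) (h w))" if pt: "prefix x (drop t (h w))" for t
  proof -
    obtain y where "drop t (h w) = x @ y"
      using pt by (auto simp: prefix_def)
    then have "drop (j + t) (h w) = drop j x @ drop (j - length x) y"
      by (metis drop_append drop_drop)
    then show ?thesis
      using m(2) by (auto simp: prefix_def)
  qed
  have "(j + (s + p)) mod 24 = (j + s) mod 24"
    using marker_residue[OF assms(1) m(1)] pre assms(3,4) by metis
  then have "24 dvd (j + (s + p)) - (j + s)"
    by (subst (asm) mod_eq_dvd_iff_nat) simp_all
  then show ?thesis
    by simp
qed


section \<open>Squares whose period is a multiple of 24\<close>

lemma squarefree_word_nthD: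
  assumes "squarefree_word w" and "q > 0" and "i + 2 * q \<le> length w"
  shows "\<exists>k<q. w ! (i + k) \<noteq> w ! (i + q + k)"
proof (rule ccontr)
  assume "\<not> ?thesis"
  then have eq: "take q (drop i w) = take q (drop (i + q) w)"
    using assms(3) by (intro nth_equalityI) auto
  define x where "x = take q (drop i w)"
  have "drop i w = x @ x @ drop (i + 2 * q) w"
    using eq unfolding x_def by (metis append_take_drop_id drop_drop add.commute add.left_commute mult_2)
  then have "sublist (x @ x) w"
    by (metis append.assoc append_take_drop_id sublist_def)
  moreover have "x \<noteq> []"
    using assms by (auto simp: x_def)
  ultimately show False
    using assms(1) unfolding squarefree_word_def is_square_def by blast
qed

text \<open>Position 3 separates the letters 1, 2 from 0, 3, 4; then position 8 separates 1 from 2,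
  position 6 separates 0 from 3 and 4, and position 9 separates 3 from 4.\<close>

lemma h_letter_eqI_prefix:
  assumes "a \<in> Sigma5" "b \<in> Sigma5" and "\<And>t. t < 10 \<Longrightarrow> h_letter a ! t = h_letter b ! t"
  shows "a = b"
  using assms(1,2) assms(3)[of 3] assms(3)[of 6] assms(3)[of 8] assms(3)[of 9]
  by (auto simp: Sigma5_def h_letter_def)

text \<open>The images of 2 and 3 differ at position 9 but agree from position 10 on, which dictates
  the start of the range.\<close>

lemma h_letter_eqI_suffix:
  assumes "a \<in> Sigma5" "b \<in> Sigma5"
    and "\<And>t. 9 \<le> t \<Longrightarrow> t < 24 \<Longrightarrow> h_letter a ! t = h_letter b ! t"
  shows "a = b"
proof -
  have "\<forall>t \<in> {9,10,11,12,13,14,15,16,17,18,19,20,21,22,23}. h_letter a ! t = h_letter b ! t"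
    using assms(3) by simp
  then show ?thesis
    using assms(1,2) by (auto simp: Sigma5_def h_letter_def)
qed

lemma no_aligned_square:
  assumes w: "w \<in> lists Sigma5" "squarefree_word w" and "q > 0"
    and len: "s + 2 * (24 * q) \<le> length (h w)"
    and eq: "\<And>j. j < 24 * q \<Longrightarrow> h w ! (s + j) = h w ! (s + 24 * q + j)"
  shows False
proof -
  define i where "i = s div 24"
  define r where "r = s mod 24"
  have s: "s = 24 * i + r" and r: "r < 24"
    by (auto simp: i_def r_def)
  have len': "24 * i + r + 48 * q \<le> 24 * length w"
    using len w(1) by (simp add: s length_h)
  \<comment> \<open>The bounds say that position \<open>t\<close> of block \<open>i + k\<close> lies
    in the first half of the square; its partner is \<open>q\<close> blocks later.\<close>
  have letter: "h_letter (w ! (i + k)) ! t = h_letter (w ! (i + q + k)) ! t"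
    if "t < 24" "r \<le> 24 * k + t" "24 * k + t < r + 24 * q" for k t
  proof -
    have "s + (24 * k + t - r) = 24 * (i + k) + t"
      "s + 24 * q + (24 * k + t - r) = 24 * (i + q + k) + t"
      using that by (auto simp: s algebra_simps)
    moreover have "i + q + k < length w"
      using that len' by linarith
    moreover have "24 * k + t - r < 24 * q"
      using that by linarith
    ultimately have "h w ! (24 * (i + k) + t) = h w ! (24 * (i + q + k) + t)"
      using eq[of "24 * k + t - r"] by metis
    with \<open>i + q + k < length w\<close> \<open>t < 24\<close> show ?thesis
      using h_nth[OF w(1), of "i + k" t] h_nth[OF w(1), of "i + q + k" t] by simp
  qed
  have in_Sigma5: "w ! k \<in> Sigma5" if "k < length w" for k
    using that w(1) by auto
  show False
  proof (cases "r \<le> 9")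
    case True
    \<comment> \<open>The square covers at least positions 9 to 23 of block \<open>i\<close>, so the
      comparison can start there.\<close>
    have "w ! (i + k) = w ! (i + q + k)" if "k < q" for k
      using True that len'
      by - (rule h_letter_eqI_suffix; (rule in_Sigma5 | rule letter); linarith)
    moreover have "i + 2 * q \<le> length w"
      using len' by linarith
    ultimately show False
      using squarefree_word_nthD[OF w(2) \<open>q > 0\<close>] by blast
  next
    case False
    \<comment> \<open>The comparison starts one block later; its last pair is \<open>i + q\<close>
      and \<open>i + 2 * q\<close>, and of the latter the square covers just the first
      \<open>r \<ge> 10\<close> letters.\<close>
    have "w ! (i + (k + 1)) = w ! (i + q + (k + 1))" if "k < q" for k
      using False r that len'
      by - (rule h_letter_eqI_prefix; (rule in_Sigma5 | rule letter); simp)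
    \<comment> \<open>As \<open>r > 0\<close>, the square ends inside block
      \<open>i + 2 * q\<close>, so \<open>w\<close> has a letter there.\<close>
    moreover have "Suc i + 2 * q \<le> length w"
      using False len' by linarith
    ultimately show False
      using squarefree_word_nthD[OF w(2) \<open>q > 0\<close>, of "Suc i"] by auto
  qed
qed

lemma squarefree_h:
  assumes "is_path w" and "squarefree_word w"
  shows "squarefree_word (h w)"
  unfolding squarefree_word_def
proof
  assume "\<exists>u. is_square u \<and> sublist u (h w)"
  then obtain x y z where x: "x \<noteq> []" and hw: "h w = y @ (x @ x) @ z"
    unfolding is_square_def sublist_def by blast
  define s where "s = length y"
  define p where "p = length x"
  have pre: "prefix (x @ x) (drop s (h w))"
    by (simp add: hw s_def)
  then have "\<not> p \<le> 30"
    using no_short_square[OF assms(1) x] p_def by blast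
  then have "p \<ge> 31"
    by simp
  moreover have "prefix x (drop s (h w))" "prefix x (drop (s + p) (h w))"
    by (auto simp: hw s_def p_def)
  ultimately have "24 dvd p"
    using long_repetition_dvd[OF assms(1)] by (simp add: p_def)
  then obtain q where q: "p = 24 * q" ..
  have "q > 0"
    using \<open>p \<ge> 31\<close> q by simp
  moreover have "s + 2 * (24 * q) \<le> length (h w)"
    using q by (simp add: hw s_def p_def)
  moreover have "h w ! (s + j) = h w ! (s + 24 * q + j)" if "j < 24 * q" for j
    using that unfolding q[symmetric] by (simp add: hw s_def p_def nth_append)
  ultimately show False
    using no_aligned_square assms is_path_Sigma5 by blast
qed


section \<open>Forbidden factors of the image\<close>

text \<open>A factor of at most 3 letters meets at most two blocks.\<close>

lemma no_forbidden_factor_short: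
  "\<forall>v \<in> set (paths 2).
     \<forall>u \<in> set [[0,2], [0,3], [0,4], [1,3], [1,4], [2,0], [2,4], [3,0], [3,1], [4,1], [4,2],
            [0,1,0], [4,3,4]]. \<not> sublist u (h v)"
  by code_simp

lemma no_forbidden_factor:
  assumes "is_path w"
    and u: "u \<in> set [[0,2], [0,3], [0,4], [1,3], [1,4], [2,0], [2,4], [3,0], [3,1], [4,1], [4,2],
            [0,1,0], [4,3,4]]"
  shows "\<not> sublist u (h w)"
proof
  assume "sublist u (h w)"
  then obtain y z where "h w = y @ u @ z"
    by (auto simp: sublist_def)
  then have "prefix u (drop (length y) (h w))"
    by simp
  moreover have "length u \<le> 3"
    using u by auto
  moreover have "length y mod 24 < 24" by simp
  ultimately obtain v where "v \<in> set (paths 2)" "prefix u (drop (length y mod 24) (h v))"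
    using factor_in_short_path[OF assms(1), of u "length y" 2] by fastforce
  then have "sublist u (h v)"
    by (meson prefix_imp_sublist sublist_drop sublist_order.order_trans)
  then show False
    using no_forbidden_factor_short \<open>v \<in> set (paths 2)\<close> u by blast
qed

theorem theorem9:
  fixes w :: "nat list"
  assumes "w \<in> lists Sigma5"
    and "squarefree_word w"
    and "\<forall>u \<in> {[0,2], [0,3], [0,4], [1,4], [2,0], [3,0], [4,1]}. \<not> sublist u w"
  shows "squarefree_word (h w) \<and>
    (\<forall>u \<in> {[0,2], [0,3], [0,4], [1,3], [1,4], [2,0], [2,4], [3,0], [3,1], [4,1], [4,2],
            [0,1,0], [4,3,4]}. \<not> sublist u (h w))"
  using squarefree_h no_forbidden_factor is_pathI[OF assms] assms(2) by simp

end
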